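(* Let $d\ge2$. For every $\Lambda\in\mathcal L_d$, $A\Lambda\cap\mathcal{WR}_d\ne\emptyset$.
   Context: Let $q$ be a prime power, $\mathcal R=\mathbb F_q[x]$, and $\tilde{\mathcal K}=\mathbb F_q((x^{-1}))$, with the absolute value $|\cdot|$ extending $|f|=q^{\deg f}$ for nonzero $f\in\mathcal R$ (and $|0|=0$). On $\tilde{\mathcal K}^d$ use the norm $\|\mathbf v\|=\max_i|v_i|$. $\mathcal L_d$ is the space of unimodular lattices in $\tilde{\mathcal K}^d$, i.e. sets $g\mathcal R^d$ with $g$ an invertible $d\times d$ matrix over $\tilde{\mathcal K}$ with $|\det(g)|=1$. $A$ is the group of diagonal $d\times d$ matrices over $\tilde{\mathcal K}$ with determinant $1$, and $A\Lambda=\{\mathbf a\Lambda:\mathbf a\in A\}\subseteq\mathcal L_d$. Let $\ell(\Lambda)=\min\{\|\mathbf v\|:\mathbf v\in\Lambda\setminus\{0\}\}$. A lattice $\Lambda\in\mathcal L_d$ is well rounded if it contains $d$ linearly independent vectors of norm $\ell(\Lambda)$; $\mathcal{WR}_d$ is the set of well rounded lattices in $\mathcal L_d$. *)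

theory Defs
  imports "HOL-Analysis.Analysis" "HOL-Computational_Algebra.Formal_Laurent_Series"
begin

text \<open>
  For a finite field \<open>'a\<close> with \<open>q\<close> elements, \<open>'a fls\<close> plays the role of the field of Laurent
  series in the inverse of \<open>x\<close>: the formal variable \<^const>\<open>fls_X\<close> is \<open>1/x\<close>, so that
  \<open>x\<close> itself is \<^const>\<open>fls_X_inv\<close>. The dimension \<open>d\<close> is the cardinality of the index type \<open>'d\<close>.
\<close>

definition poly_to_fls :: "'a::field poly \<Rightarrow> 'a fls" where
  "poly_to_fls p = poly (map_poly fls_const p) fls_X_inv"

definition poly_ring :: "'a::field fls set" where
  "poly_ring = range poly_to_fls"

definition fls_abs :: "'a::{field,finite} fls \<Rightarrow> real" where
  "fls_abs f = (if f = 0 then 0 else real CARD('a) powi (- fls_subdegree f))"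

lemma poly_to_fls_0 [simp]: "poly_to_fls 0 = 0"
  by (simp add: poly_to_fls_def)

lemma poly_to_fls_pCons: "poly_to_fls (pCons c p) = fls_const c + fls_X_inv * poly_to_fls p"
  by (simp add: poly_to_fls_def map_poly_pCons)

lemma fls_nth_poly_to_fls:
  "fls_nth (poly_to_fls p) k = (if k \<le> 0 then coeff p (nat (- k)) else 0)"
proof (induction p arbitrary: k)
  case 0
  show ?case by simp
next
  case (pCons c p)
  have "nat (- k) = Suc (nat (- 1 - k))" if "k < 0"
    using that by simp
  then show ?case
    by (auto simp: poly_to_fls_pCons pCons.IH fls_X_inv_times_conv_shift coeff_pCons
        algebra_simps split: nat.splits)
qed

text \<open>The absolute value extends the one on polynomials given by the degree.\<close>

lemma fls_abs_poly_to_fls: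
  fixes p :: "'a::{field,finite} poly"
  assumes "p \<noteq> 0"
  shows "fls_abs (poly_to_fls p) = real CARD('a) ^ degree p"
proof -
  have lead: "fls_nth (poly_to_fls p) (- int (degree p)) \<noteq> 0"
    using assms by (simp add: fls_nth_poly_to_fls)
  have "fls_subdegree (poly_to_fls p) = - int (degree p)"
    using lead by (intro fls_subdegree_eqI) (auto simp: fls_nth_poly_to_fls intro: coeff_eq_0)
  moreover have "poly_to_fls p \<noteq> 0"
    using lead by auto
  ultimately show ?thesis
    by (simp add: fls_abs_def)
qed

definition vec_norm :: "'a::{field,finite} fls ^ 'd \<Rightarrow> real" where
  "vec_norm v = Max (range (\<lambda>i. fls_abs (v $ i)))"

definition unimodular_lattices :: "('a::{field,finite} fls ^ 'd) set set" where
  "unimodular_lattices =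
     {(\<lambda>v. g *v v) ` {v. \<forall>i. v $ i \<in> poly_ring} | g :: 'a fls ^ 'd ^ 'd.
        invertible g \<and> fls_abs (det g) = 1}"

definition diagonal_group :: "('a::field fls ^ 'd ^ 'd) set" where
  "diagonal_group = {a. (\<forall>i j. i \<noteq> j \<longrightarrow> a $ i $ j = 0) \<and> det a = 1}"

definition diagonal_orbit :: "('a::field fls ^ 'd) set \<Rightarrow> ('a fls ^ 'd) set set" where
  "diagonal_orbit \<Lambda> = {(\<lambda>v. a *v v) ` \<Lambda> | a. a \<in> diagonal_group}"

text \<open>
  \<open>LEAST\<close> expresses the minimum; it is attained for lattices, whose nonzero vectors have
  norms in a discrete set bounded away from zero.
\<close>

definition shortest_length :: "('a::{field,finite} fls ^ 'd) set \<Rightarrow> real" where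
  "shortest_length \<Lambda> = (LEAST r. r \<in> vec_norm ` (\<Lambda> - {0}))"

definition well_rounded_lattices :: "('a::{field,finite} fls ^ 'd) set set" where
  "well_rounded_lattices =
     {\<Lambda> \<in> unimodular_lattices.
        \<exists>S \<subseteq> \<Lambda>. card S = CARD('d) \<and> vec.independent S \<and>
          (\<forall>v\<in>S. vec_norm v = shortest_length \<Lambda>)}"

end

theory Submission
  imports Defs
begin

text \<open>
  Scaling coordinate \<open>i\<close> by a power of \<open>x\<close> turns the open unit ball into a box
  \<open>{v. ord (v\<^sub>i) > m\<^sub>i for all i}\<close>, where \<open>ord\<close> is the order of vanishing at
  \<open>x = \<infinity>\<close>. Since the diagonal scaling must have determinant \<open>1\<close>, a well rounded lattice
  in the orbit of \<open>\<Lambda>\<close> comes from integers \<open>m\<^sub>i\<close> of sum \<open>0\<close> whose box meets \<open>\<Lambda>\<close>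
  only in \<open>0\<close>, together with \<open>d\<close> independent vectors of \<open>\<Lambda>\<close> on the boundary of that box.

  Call a box empty if it contains no nonzero vector of \<open>\<Lambda>\<close>. Empty boxes exist because
  \<open>\<Lambda>\<close> is discrete (\<open>lattice_discrete\<close>), and they cannot be arbitrarily large by the
  pigeonhole principle (\<open>sum_lower_bound_of_empty_box\<close>). So there is a maximal one
  (\<open>maximal_empty_box\<close>): for every \<open>i\<close>, enlarging the box by one step in direction \<open>i\<close> lets
  in a lattice vector \<open>v\<^sub>i\<close>. After scaling by \<open>x ^ m\<^sub>i\<close> in each coordinate, \<open>v\<^sub>i\<close> has
  \<open>i\<close>-th entry of absolute value \<open>1\<close> and all its other entries smaller than \<open>1\<close>. So the matrix
  \<open>W\<close> with these columns reduces to an invertible diagonal matrix modulo the maximal ideal of the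
  valuation ring; in particular \<open>|det W| = 1\<close> and the columns are independent vectors of norm
  \<open>1\<close>, the smallest norm that the empty box allows
  (\<open>well_rounded_if_residually_diagonal\<close>).

  It remains to see that the sum of the \<open>m\<^sub>i\<close> is automatically \<open>0\<close>. Every series is a
  polynomial plus a series of absolute value less than \<open>1\<close>, and \<open>W\<close> preserves the open unit
  ball. So any vector of the scaled lattice differs from a polynomial combination of the columns
  by a lattice vector in the empty box, that is, by \<open>0\<close>. The columns therefore generate the
  scaled lattice, whose covolume is then \<open>|det W| = 1\<close>
  (\<open>fls_subdegree_det_eq_0_if_residually_diagonal\<close>); but \<open>\<Lambda>\<close> has covolume \<open>1\<close> too, so
  the scaling does not change covolume.
\<close>

no_notation fps_nth (infixl \<open>$\<close> 75)
notation fls_nth (infixl \<open>$$\<close> 75)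

section \<open>Orders of vanishing and the polynomial ring\<close>

lemma fls_times_nth_lowest:
  fixes f g :: "'a::field fls"
  assumes f: "\<And>k. k < a \<Longrightarrow> f $$ k = 0" and g: "\<And>k. k < b \<Longrightarrow> g $$ k = 0"
  shows fls_times_nth_below: "k < a + b \<Longrightarrow> (f * g) $$ k = 0"
    and fls_times_nth_add: "(f * g) $$ (a + b) = f $$ a * g $$ b"
proof -
  have *: "(k < a + b \<longrightarrow> (f * g) $$ k = 0) \<and> (f * g) $$ (a + b) = f $$ a * g $$ b"
  proof (cases "f = 0 \<or> g = 0")
    case False
    then have sf: "a \<le> fls_subdegree f" and sg: "b \<le> fls_subdegree g"
      using f g by (auto intro: fls_subdegree_geI)
    show ?thesis
    proof (cases "a = fls_subdegree f \<and> b = fls_subdegree g")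
      case True
      then show ?thesis
        by (simp add: fls_times_nth_eq0 fls_times_base)
    next
      case False
      then have "a < fls_subdegree f \<or> b < fls_subdegree g"
        using sf sg by auto
      moreover have "a + b < fls_subdegree f + fls_subdegree g"
        using sf sg False by auto
      ultimately show ?thesis
        using sf sg by (auto simp: fls_times_nth_eq0)
    qed
  qed auto
  show "k < a + b \<Longrightarrow> (f * g) $$ k = 0" "(f * g) $$ (a + b) = f $$ a * g $$ b"
    using * by auto
qed

lemma poly_ring_iff: "f \<in> poly_ring \<longleftrightarrow> (\<forall>k>0. f $$ k = 0)"
proof
  assume R: "\<forall>k>0. f $$ k = 0"
  define c where "c n = f $$ (- int n)" for n :: nat
  have "c n = 0" if "n > nat (- fls_subdegree f)" for n
    using that by (simp add: c_def)
  then have "coeff (Abs_poly c) = c"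
    by (rule coeff_Abs_poly)
  then have "f = poly_to_fls (Abs_poly c)"
    using R by (intro fls_eqI) (auto simp: fls_nth_poly_to_fls c_def)
  then show "f \<in> poly_ring"
    by (simp add: poly_ring_def)
qed (auto simp: poly_ring_def fls_nth_poly_to_fls)

lemma poly_ring_0 [simp]: "0 \<in> poly_ring"
  and poly_ring_1 [simp]: "1 \<in> poly_ring"
  and poly_ring_add: "f \<in> poly_ring \<Longrightarrow> g \<in> poly_ring \<Longrightarrow> f + g \<in> poly_ring"
  and poly_ring_uminus: "f \<in> poly_ring \<Longrightarrow> - f \<in> poly_ring"
  and poly_ring_diff: "f \<in> poly_ring \<Longrightarrow> g \<in> poly_ring \<Longrightarrow> f - g \<in> poly_ring"
  by (auto simp: poly_ring_iff)

lemma poly_ring_mult: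
  assumes "f \<in> poly_ring" "g \<in> poly_ring"
  shows "f * g \<in> poly_ring"
proof -
  obtain p where f: "f = poly_to_fls p"
    using assms by (auto simp: poly_ring_def)
  have "poly_to_fls p * g \<in> poly_ring"
  proof (induction p)
    case (pCons c p)
    have "fls_const c * g \<in> poly_ring"
      using assms by (simp add: poly_ring_iff)
    moreover have "fls_X_inv * (poly_to_fls p * g) \<in> poly_ring"
      using pCons.IH by (simp add: poly_ring_iff fls_X_inv_times_conv_shift)
    ultimately show ?case
      by (simp add: poly_to_fls_pCons distrib_right mult.assoc poly_ring_add)
  qed simp
  then show ?thesis
    by (simp add: f)
qed

lemma fls_subdegree_poly_ring: "f \<in> poly_ring \<Longrightarrow> f \<noteq> 0 \<Longrightarrow> fls_subdegree f \<le> 0"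
  by (meson not_le nth_fls_subdegree_nonzero poly_ring_iff)

lemma poly_ring_small_eq_0: "f \<in> poly_ring \<Longrightarrow> (\<And>k. k \<le> 0 \<Longrightarrow> f $$ k = 0) \<Longrightarrow> f = 0"
  by (metis fls_eqI fls_zero_nth not_le poly_ring_iff)

text \<open>
  Splitting off the polynomial part gives \<open>K = R + {f. |f| < 1}\<close>, where \<open>K\<close> is the field
  of series and \<open>R\<close> the polynomial ring: the open unit ball is a fundamental domain for \<open>R\<close>.
\<close>

lemma poly_ring_decomp:
  fixes f :: "'a::field fls"
  obtains p where "p \<in> poly_ring" "\<And>k. k \<le> 0 \<Longrightarrow> (f - p) $$ k = 0"
proof
  define r where "r = fps_to_fls (Abs_fps (\<lambda>n. if n = 0 then 0 else f $$ int n))"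
  show "f - r \<in> poly_ring"
    by (auto simp: poly_ring_iff r_def)
  show "k \<le> 0 \<Longrightarrow> (f - (f - r)) $$ k = 0" for k
    by (auto simp: r_def)
qed

section \<open>Determinants\<close>

text \<open>
  A determinant is a polynomial expression in the entries. Taking for \<open>R\<close> membership in a subring
  (ignoring the second argument), or the graph of a homomorphism defined on a subring, transfers
  determinants to that subring or along that homomorphism.
\<close>

lemma det_related:
  fixes A :: "'a::comm_ring_1 ^ 'd ^ 'd" and B :: "'b::comm_ring_1 ^ 'd ^ 'd"
  assumes 0: "R 0 0" and 1: "R 1 1"
    and add: "\<And>x x' y y'. R x x' \<Longrightarrow> R y y' \<Longrightarrow> R (x + y) (x' + y')"
    and mult: "\<And>x x' y y'. R x x' \<Longrightarrow> R y y' \<Longrightarrow> R (x * y) (x' * y')"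
    and neg: "\<And>x x'. R x x' \<Longrightarrow> R (- x) (- x')"
    and ent: "\<And>i j. R (A $ i $ j) (B $ i $ j)"
  shows "R (det A) (det B)"
proof -
  have prod_R: "R (prod f S) (prod g S)" if "\<And>x. R (f x) (g x)"
    for f g and S :: "'d set"
    by (induction S rule: infinite_finite_induct) (auto simp: 1 mult that)
  have sum_R: "R (sum f S) (sum g S)" if "\<And>x. R (f x) (g x)"
    for f g and S :: "('d \<Rightarrow> 'd) set"
    by (induction S rule: infinite_finite_induct) (auto simp: 0 add that)
  have "R (of_int (sign p) * (\<Prod>i\<in>UNIV. A $ i $ p i))
          (of_int (sign p) * (\<Prod>i\<in>UNIV. B $ i $ p i))" for p
    by (auto simp: sign_def neg prod_R ent)
  then show ?thesis
    unfolding det_def by (rule sum_R)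
qed

lemma det_poly_ring:
  fixes A :: "'a::field fls ^ 'd ^ 'd"
  assumes "\<And>i j. A $ i $ j \<in> poly_ring"
  shows "det A \<in> poly_ring"
  by (rule det_related[where R = "\<lambda>f _. f \<in> poly_ring" and B = A])
    (use assms in \<open>auto intro: poly_ring_add poly_ring_mult poly_ring_uminus\<close>)

text \<open>
  The matrix has entries in the valuation ring, on which the coefficient at \<open>0\<close> is a ring
  homomorphism to the residue field. It sends the determinant to that of an invertible diagonal
  matrix, so the determinant is a unit of the valuation ring.
\<close>

lemma fls_subdegree_det_diagonal_residue:
  fixes W :: "'a::field fls ^ 'd ^ 'd"
  assumes int: "\<And>i j k. k < 0 \<Longrightarrow> W $ i $ j $$ k = 0"
    and off: "\<And>i j. i \<noteq> j \<Longrightarrow> W $ i $ j $$ 0 = 0"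
    and diag: "\<And>i. W $ i $ i $$ 0 \<noteq> 0"
  shows "det W \<noteq> 0" "fls_subdegree (det W) = 0"
proof -
  define R where "R f c \<longleftrightarrow> (\<forall>k<0. f $$ k = 0) \<and> f $$ 0 = c" for f :: "'a fls" and c
  define B :: "'a ^ 'd ^ 'd" where "B = (\<chi> i j. W $ i $ j $$ 0)"
  have R: "R (det W) (det B)"
  proof (rule det_related[where R = R])
    show "R (x * y) (x' * y')" if "R x x'" "R y y'" for x x' y y'
      using that fls_times_nth_below[of 0 x 0 y] fls_times_nth_add[of 0 x 0 y]
      by (auto simp: R_def)
  qed (use int in \<open>auto simp: R_def B_def\<close>)
  have "det B = (\<Prod>i\<in>UNIV. B $ i $ i)"
    by (rule det_diagonal) (simp add: B_def off)
  then have "det B \<noteq> 0"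
    using diag by (simp add: B_def)
  with R show "det W \<noteq> 0" "fls_subdegree (det W) = 0"
    by (auto simp: R_def intro!: fls_subdegree_eqI)
qed

section \<open>Lattices and boxes\<close>

definition lattice :: "'a::field fls ^ 'd ^ 'd \<Rightarrow> ('a fls ^ 'd) set" where
  "lattice g = (\<lambda>v. g *v v) ` {v. \<forall>i. v $ i \<in> poly_ring}"

text \<open>
  Orders of vanishing are minus degrees, so the box grows when \<open>m\<close> decreases: it consists of the
  vectors with \<open>deg (v\<^sub>i) < - m\<^sub>i\<close>.
\<close>

definition vanishing_box :: "('d \<Rightarrow> int) \<Rightarrow> ('a::field fls ^ 'd) set" where
  "vanishing_box m = {v. \<forall>i. \<forall>k\<le>m i. v $ i $$ k = 0}"

lemma lattice_diff: "u \<in> lattice g \<Longrightarrow> v \<in> lattice g \<Longrightarrow> u - v \<in> lattice g"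
  by (auto simp: lattice_def intro!: image_eqI[where x = "x - y" for x y]
      simp: matrix_vector_mult_diff_distrib poly_ring_diff)

lemma lattice_matrix_mult: "lattice (a ** g) = (\<lambda>v. a *v v) ` lattice g"
  by (simp add: lattice_def image_image matrix_vector_mul_assoc)

lemma sum_poly_ring: "(\<And>i. i \<in> S \<Longrightarrow> f i \<in> poly_ring) \<Longrightarrow> sum f S \<in> poly_ring"
  by (induction S rule: infinite_finite_induct) (auto intro: poly_ring_add)

lemma lattice_mult_poly_matrix:
  assumes "\<And>i j. P $ i $ j \<in> poly_ring"
  shows "lattice (g ** P) \<subseteq> lattice g"
proof -
  have "g *v (P *v v) \<in> lattice g" if "\<forall>i. v $ i \<in> poly_ring" for v
    unfolding lattice_def using that assms
    by (intro imageI) (auto simp: matrix_vector_mult_def intro!: sum_poly_ring poly_ring_mult)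
  then show ?thesis
    by (auto simp: lattice_def matrix_vector_mul_assoc)
qed

lemma column_in_lattice: "column j g \<in> lattice g"
proof -
  have "g *v axis j 1 = column j g"
    by (simp add: vec_eq_iff matrix_vector_mult_def column_def axis_def if_distrib cong: if_cong)
  then show ?thesis
    unfolding lattice_def by (intro image_eqI[where x = "axis j 1"]) (auto simp: axis_def)
qed

lemma columns_in_lattice_factor:
  fixes g V :: "'a::field fls ^ 'd ^ 'd"
  assumes "\<And>j. column j V \<in> lattice g"
  obtains P where "V = g ** P" "\<And>i j. P $ i $ j \<in> poly_ring"
proof -
  have "\<exists>p. column j V = g *v p \<and> (\<forall>i. p $ i \<in> poly_ring)" for j
    using assms[of j] by (auto simp: lattice_def)
  then obtain p where p: "\<And>j. column j V = g *v p j" "\<And>j i. p j $ i \<in> poly_ring"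
    by metis
  show ?thesis
  proof
    show "V = g ** (\<chi> i j. p j $ i)"
      using p(1) by (simp add: vec_eq_iff column_def matrix_matrix_mult_def matrix_vector_mult_def)
  qed (use p in auto)
qed

text \<open>
  The transition matrix of a sublattice is polynomial, and a nonzero polynomial has absolute value at
  least \<open>1\<close>; so covolume can only grow on passing to a sublattice.
\<close>

lemma fls_subdegree_det_mono:
  fixes g V :: "'a::field fls ^ 'd ^ 'd"
  assumes "\<And>j. column j V \<in> lattice g" "det V \<noteq> 0"
  shows "fls_subdegree (det V) \<le> fls_subdegree (det g)"
proof -
  obtain P where P: "V = g ** P" "\<And>i j. P $ i $ j \<in> poly_ring"
    using columns_in_lattice_factor assms by blast
  have "det g \<noteq> 0" "det P \<noteq> 0"
    using assms(2) P(1) by (auto simp: det_mul)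
  moreover have "fls_subdegree (det P) \<le> 0"
    using calculation det_poly_ring P(2) fls_subdegree_poly_ring by blast
  ultimately show ?thesis
    by (simp add: P(1) det_mul)
qed

text \<open>
  The open unit ball is disjoint from the nonzero vectors of \<open>lattice h\<close>, and it is at the
  same time a fundamental domain for the sublattice generated by the columns of \<open>W\<close>, because
  \<open>W\<close> preserves it. This forces the two lattices to coincide, and their determinants to have
  equal order.
\<close>

lemma fls_subdegree_det_eq_0_if_residually_diagonal:
  fixes h W :: "'a::field fls ^ 'd ^ 'd"
  assumes empty: "lattice h \<inter> vanishing_box (\<lambda>_. 0) \<subseteq> {0}"
    and W: "\<And>j. column j W \<in> lattice h"
    and h: "det h \<noteq> 0"
    and int: "\<And>i j k. k < 0 \<Longrightarrow> W $ i $ j $$ k = 0"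
    and off: "\<And>i j. i \<noteq> j \<Longrightarrow> W $ i $ j $$ 0 = 0"
    and diag: "\<And>i. W $ i $ i $$ 0 \<noteq> 0"
  shows "fls_subdegree (det h) = 0"
proof -
  have dW: "det W \<noteq> 0" "fls_subdegree (det W) = 0"
    using fls_subdegree_det_diagonal_residue int off diag by blast+
  have le: "lattice h \<subseteq> lattice W"
  proof
    fix u assume u: "u \<in> lattice h"
    \<comment> \<open>Round the coordinates of \<open>u\<close> in the basis \<open>W\<close> to polynomials.\<close>
    have "surj ((*v) W)"
      using dW(1) by (meson invertible_det_nz invertible_eq_bij bij_is_surj)
    then obtain y where y: "u = W *v y"
      by (metis surjD)
    have "\<exists>q\<in>poly_ring. \<forall>k\<le>0. (y $ i - q) $$ k = 0" for i
      by (metis poly_ring_decomp)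
    then obtain q where q: "\<And>i. q i \<in> poly_ring" "\<And>i k. k \<le> 0 \<Longrightarrow> (y $ i - q i) $$ k = 0"
      by metis
    define p where "p = (\<chi> i. q i)"
    have Wp: "W *v p \<in> lattice W"
      using q(1) by (auto simp: lattice_def p_def)
    have "lattice W \<subseteq> lattice h"
      using columns_in_lattice_factor[OF W] lattice_mult_poly_matrix by metis
    then have "u - W *v p \<in> lattice h"
      using u Wp by (blast intro: lattice_diff)
    moreover have "u - W *v p \<in> vanishing_box (\<lambda>_. 0)"
    proof -
      have "(W $ i $ j * (y $ j - q j)) $$ k = 0" if "k \<le> 0" for i j k
        using that int q(2) by (intro fls_times_nth_below[of 0 _ 1]) auto
      moreover have "u - W *v p = W *v (y - p)"
        by (simp add: y matrix_vector_mult_diff_distrib)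
      ultimately show ?thesis
        by (simp add: vanishing_box_def matrix_vector_mult_def fls_nth_sum p_def)
    qed
    ultimately have "u = W *v p"
      using empty by auto
    with Wp show "u \<in> lattice W" by simp
  qed
  have "fls_subdegree (det W) \<le> fls_subdegree (det h)"
    using W dW by (intro fls_subdegree_det_mono)
  moreover have "fls_subdegree (det h) \<le> fls_subdegree (det W)"
    using h le column_in_lattice by (intro fls_subdegree_det_mono) blast+
  ultimately show ?thesis
    using dW by simp
qed

lemma matrix_common_lower_order:
  fixes A :: "'a::field fls ^ 'd ^ 'e"
  obtains N where "\<And>i j k. k < N \<Longrightarrow> A $ i $ j $$ k = 0"
proof
  define N where "N = Min (range (\<lambda>(i, j). fls_subdegree (A $ i $ j)))"
  fix i j k assume "k < N"
  also have "N \<le> fls_subdegree (A $ i $ j)"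
    unfolding N_def by (rule Min_le) (auto intro!: rev_image_eqI[of "(i, j)"])
  finally show "A $ i $ j $$ k = 0" by simp
qed

text \<open>
  If \<open>g p\<close> is small then so is \<open>p\<close>, by multiplying with the inverse of \<open>g\<close>, and a polynomial
  of absolute value less than \<open>1\<close> vanishes.
\<close>

lemma lattice_discrete:
  fixes g :: "'a::field fls ^ 'd ^ 'd"
  assumes "invertible g"
  obtains m where "lattice g \<inter> vanishing_box m \<subseteq> {0}"
proof -
  obtain g' where g': "g' ** g = mat 1"
    using assms by (auto simp: invertible_def)
  obtain N where N: "\<And>i j k. k < N \<Longrightarrow> g' $ i $ j $$ k = 0"
    by (rule matrix_common_lower_order) blast
  show ?thesis
  proof
    show "lattice g \<inter> vanishing_box (\<lambda>_. - N) \<subseteq> {0}"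
    proof
      fix v assume v: "v \<in> lattice g \<inter> vanishing_box (\<lambda>_. - N)"
      then obtain p where p: "v = g *v p" "\<And>i. p $ i \<in> poly_ring"
        by (auto simp: lattice_def)
      have "p = g' *v v"
        by (simp add: p(1) matrix_vector_mul_assoc g')
      moreover have "(g' $ i $ j * v $ j) $$ k = 0" if "k \<le> 0" for i j k
        using that N v by (intro fls_times_nth_below[of N _ "1 - N"]) (auto simp: vanishing_box_def)
      ultimately have "p $ i $$ k = 0" if "k \<le> 0" for i k
        using that by (simp add: matrix_vector_mult_def fls_nth_sum)
      then have "p $ i = 0" for i
        using p(2) poly_ring_small_eq_0 by blast
      then have "p = 0"
        by (simp add: vec_eq_iff)
      then show "v \<in> {0}" by (simp add: p(1))
    qed
  qed
qed

text \<open>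
  The pigeonhole argument of Minkowski, with a crude constant. The vectors of \<open>d\<close> polynomials of
  degree at most \<open>M\<close> have \<open>d (M + 1)\<close> free coefficients. If all entries of \<open>g\<close> have order at
  least \<open>c\<close>, then \<open>g p\<close> has order at least \<open>c - M\<close>, and its class modulo the box is
  given by its coefficients at the positions \<open>c - M, \<dots>, m\<^sub>i\<close>. When the box is empty this
  class determines \<open>p\<close>, so there are at least \<open>d (M + 1)\<close> such positions; comparing the two
  counts gives the bound \<open>d c\<close>, independent of \<open>M\<close>.
\<close>

lemma sum_lower_bound_of_empty_box:
  fixes g :: "'a::{field,finite} fls ^ 'd ^ 'd"
  assumes g: "invertible g"
  shows "\<exists>B. \<forall>m. lattice g \<inter> vanishing_box m \<subseteq> {0} \<longrightarrow> B \<le> (\<Sum>i\<in>UNIV. m i)"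
proof -
  obtain c where c: "\<And>i j k. k < c \<Longrightarrow> g $ i $ j $$ k = 0"
    by (rule matrix_common_lower_order) blast
  have "(\<Sum>i\<in>(UNIV::'d set). c) \<le> (\<Sum>i\<in>UNIV. m i)" if empty: "lattice g \<inter> vanishing_box m \<subseteq> {0}" for m
  proof -
    \<comment> \<open>Large enough that each range of positions has its true length, with no negative count cut off.\<close>
    define M where "M = nat (Max (range (\<lambda>i. c - m i)))"
    have M: "c - int M \<le> m i" for i
    proof -
      have "c - m i \<le> Max (range (\<lambda>i. c - m i))"
        by (rule Max_ge) auto
      then show ?thesis unfolding M_def by linarith
    qed
    define D where "D = (UNIV :: 'd set) \<times> {..M} \<rightarrow>\<^sub>E (UNIV :: 'a set)"
    define J where "J = (SIGMA i : UNIV :: 'd set. {c - int M..m i})"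
    define E where "E = J \<rightarrow>\<^sub>E (UNIV :: 'a set)"
    \<comment> \<open>\<open>f (j, n)\<close> becomes the coefficient of \<open>x ^ (M - n)\<close> in entry \<open>j\<close>.\<close>
    define p where "p f = (\<chi> j::'d. fls_shift (int M)
        (fps_to_fls (Abs_fps (\<lambda>n. if n \<le> M then f (j, n) else (0::'a)))))" for f
    define F where "F f = restrict (\<lambda>(i, k). (g *v p f) $ i $$ k) J" for f
    have p_poly: "p f $ j \<in> poly_ring" for f j
      by (auto simp: p_def poly_ring_iff)
    have p_low: "p f $ j $$ k = 0" if "k < - int M" for f j k
      using that by (simp add: p_def)
    have gp_low: "(g *v p f) $ i $$ k = 0" if "k < c - int M" for f i k
    proof -
      have "(g $ i $ j * p f $ j) $$ k = 0" for j
        using that c p_low by (intro fls_times_nth_below[of c _ "- int M"]) auto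
      then show ?thesis
        by (simp add: matrix_vector_mult_def fls_nth_sum)
    qed
    have "inj_on F D"
    proof (rule inj_onI)
      fix f f' assume f: "f \<in> D" "f' \<in> D" and eq: "F f = F f'"
      have "g *v p f - g *v p f' \<in> lattice g"
        using p_poly by (intro lattice_diff) (auto simp: lattice_def)
      moreover have "g *v p f - g *v p f' \<in> vanishing_box m"
      proof -
        have "(g *v p f) $ i $$ k = (g *v p f') $ i $$ k" if "k \<le> m i" for i k
        proof (cases "k < c - int M")
          case False
          then have "(i, k) \<in> J"
            using that by (simp add: J_def)
          then show ?thesis
            using fun_cong[OF eq, of "(i, k)"] by (simp add: F_def)
        qed (simp add: gp_low)
        then show ?thesis by (simp add: vanishing_box_def)
      qed
      ultimately have "g *v p f = g *v p f'"
        using empty by auto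
      then have pp: "p f = p f'"
        using g by (meson invertible_eq_bij bij_is_inj injD)
      have "f x = f' x" if "x \<in> UNIV \<times> {..M}" for x
      proof -
        obtain j n where x: "x = (j, n)" "n \<le> M"
          using \<open>x \<in> _\<close> by auto
        have "p f $ j $$ (int n - int M) = p f' $ j $$ (int n - int M)"
          by (simp add: pp)
        then show ?thesis
          using x by (simp add: p_def)
      qed
      then show "f = f'"
        using f unfolding D_def by (intro PiE_ext) auto
    qed
    moreover have "F ` D \<subseteq> E"
      by (auto simp: F_def E_def)
    moreover have "finite J"
      by (auto simp: J_def)
    moreover from this have "finite E"
      by (simp add: E_def finite_PiE)
    ultimately have "card D \<le> card E"
      by (metis card_inj_on_le)
    moreover have "card D = CARD('a) ^ (CARD('d) * Suc M)"
      by (simp add: D_def card_funcsetE card_cartesian_product)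
    moreover have "card E = CARD('a) ^ card J"
      using \<open>finite J\<close> by (simp add: E_def card_funcsetE)
    moreover have "card (UNIV :: 'a set) > 1"
      using card_mono[of "UNIV :: 'a set" "{0, 1}"] by simp
    ultimately have "CARD('d) * Suc M \<le> card J"
      by (metis power_le_imp_le_exp)
    moreover have "int (card J) = (\<Sum>i\<in>UNIV. m i - c + int (Suc M))"
    proof -
      have "card J = (\<Sum>i\<in>UNIV. nat (m i - c + int (Suc M)))"
        by (simp add: J_def algebra_simps)
      moreover have "m i - c + int (Suc M) \<ge> 0" for i
        using M[of i] by simp
      ultimately show ?thesis
        by simp
    qed
    ultimately have "int (CARD('d) * Suc M) \<le> (\<Sum>i\<in>UNIV. m i - c + int (Suc M))"
      by (metis of_nat_mono)
    then show ?thesis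
      by (simp add: sum.distrib sum_subtractf algebra_simps)
  qed
  then show ?thesis
    by blast
qed

section \<open>Maximal empty boxes\<close>

text \<open>
  An empty box whose sum of \<open>m\<^sub>i\<close> is least cannot be enlarged by even one step. Such a box exists
  because the sums are integers bounded below.
\<close>

lemma maximal_empty_box:
  fixes g :: "'a::{field,finite} fls ^ 'd ^ 'd"
  assumes g: "invertible g"
  obtains m where "lattice g \<inter> vanishing_box m \<subseteq> {0}"
    and "\<forall>i. \<not> lattice g \<inter> vanishing_box (m(i := m i - 1)) \<subseteq> {0}"
proof -
  define E where "E m \<longleftrightarrow> lattice g \<inter> vanishing_box m \<subseteq> {0}" for m
  obtain B where B: "E m \<Longrightarrow> B \<le> (\<Sum>i\<in>UNIV. m i)" for m
    using sum_lower_bound_of_empty_box[OF g] unfolding E_def by auto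
  obtain m0 where "E m0"
    using lattice_discrete[OF g] unfolding E_def by blast
  then obtain m where m: "E m"
    and least: "\<And>m'. E m' \<Longrightarrow> nat ((\<Sum>i\<in>UNIV. m i) - B) \<le> nat ((\<Sum>i\<in>UNIV. m' i) - B)"
    using ex_has_least_nat[of E m0 "\<lambda>m. nat ((\<Sum>i\<in>UNIV. m i) - B)"] by blast
  have "\<not> E (m(i := m i - 1))" for i
  proof
    assume E': "E (m(i := m i - 1))"
    have "(\<Sum>j\<in>UNIV. (m(i := m i - 1)) j) = (\<Sum>j\<in>UNIV. m j) - 1"
      by (simp add: sum.remove[of UNIV i])
    then show False
      using least[OF E'] B[OF E'] by linarith
  qed
  with m show ?thesis
    using that unfolding E_def by blast
qed

section \<open>Diagonal scalings and well rounded lattices\<close>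

definition diag_scaling :: "('d \<Rightarrow> int) \<Rightarrow> 'a::field fls ^ 'd ^ 'd" where
  "diag_scaling m = (\<chi> i j. if i = j then fls_X_intpow (- m i) else 0)"

lemma diag_scaling_mult: "(diag_scaling m *v v) $ i = fls_shift (m i) (v $ i)"
proof -
  have "(diag_scaling m *v v) $ i = (\<Sum>j\<in>UNIV. if i = j then fls_X_intpow (- m i) * v $ j else 0)"
    unfolding matrix_vector_mult_def diag_scaling_def vec_lambda_beta by (intro sum.cong) auto
  then show ?thesis
    using fls_X_intpow_times_conv_shift(1)[of "- m i" "v $ i"] by simp
qed

lemma det_diag_scaling:
  "det (diag_scaling m :: 'a::field fls ^ 'd ^ 'd) = fls_X_intpow (- (\<Sum>i\<in>UNIV. m i))"
proof -
  have "det (diag_scaling m :: 'a fls ^ 'd ^ 'd) = (\<Prod>i\<in>UNIV. fls_X_intpow (- m i))"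
    by (subst det_diagonal) (auto simp: diag_scaling_def)
  also have "\<dots> = fls_X_intpow (\<Sum>i\<in>S. - m i)" if "S = UNIV" for S
    unfolding that[symmetric]
    by (induction S rule: infinite_finite_induct)
      (simp_all add: fls_shifted_times_simps add.commute)
  finally show ?thesis
    by (simp add: sum_negf)
qed

lemma diag_scaling_in_vanishing_box_iff:
  "diag_scaling m *v v \<in> vanishing_box n \<longleftrightarrow> v \<in> vanishing_box (\<lambda>i. m i + n i)"
proof -
  have "(\<forall>k\<le>n i. f $$ (k + m i) = 0) \<longleftrightarrow> (\<forall>k\<le>m i + n i. f $$ k = 0)" for i and f :: "'a fls"
    by (metis add.commute add_le_cancel_left diff_add_cancel)
  then show ?thesis
    by (simp add: vanishing_box_def diag_scaling_mult)
qed

lemma fls_abs_1_iffs: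
  fixes f :: "'a::{field,finite} fls"
  shows "fls_abs f \<le> 1 \<longleftrightarrow> (\<forall>k<0. f $$ k = 0)" and "fls_abs f < 1 \<longleftrightarrow> (\<forall>k\<le>0. f $$ k = 0)"
    and "fls_abs f = 1 \<longleftrightarrow> f \<noteq> 0 \<and> fls_subdegree f = 0"
proof -
  have q: "real CARD('a) > 1"
    using card_mono[of "UNIV :: 'a set" "{0, 1}"] by simp
  have *: "real CARD('a) powi n \<le> 1 \<longleftrightarrow> n \<le> 0" "real CARD('a) powi n < 1 \<longleftrightarrow> n < 0"
     "real CARD('a) powi n = 1 \<longleftrightarrow> n = 0" for n
    using power_int_strict_increasing[of n 0 "real CARD('a)"]
      power_int_strict_increasing[of 0 n "real CARD('a)"] q
    by (cases n "0 :: int" rule: linorder_cases; simp)+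
  show "fls_abs f \<le> 1 \<longleftrightarrow> (\<forall>k<0. f $$ k = 0)"
    using fls_subdegree_ge0I[of f] by (auto simp: fls_abs_def *)
  show "fls_abs f < 1 \<longleftrightarrow> (\<forall>k\<le>0. f $$ k = 0)"
    using fls_subdegree_geI[of f 1] by (auto simp: fls_abs_def *)
  show "fls_abs f = 1 \<longleftrightarrow> f \<noteq> 0 \<and> fls_subdegree f = 0"
    by (simp add: fls_abs_def *)
qed

lemma vec_norm_less_1_iff: "vec_norm v < 1 \<longleftrightarrow> v \<in> vanishing_box (\<lambda>_. 0)"
  and vec_norm_le_1_iff: "vec_norm v \<le> 1 \<longleftrightarrow> v \<in> vanishing_box (\<lambda>_. - 1)"
  by (auto simp: vec_norm_def vanishing_box_def fls_abs_1_iffs)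

text \<open>
  The columns of \<open>W\<close> are the required vectors: integrality of the entries and the diagonal units
  give them norm exactly \<open>1\<close>, emptiness of the open unit ball makes this the minimal length, and
  the determinant being nonzero makes them independent.
\<close>

lemma well_rounded_if_residually_diagonal:
  fixes h W :: "'a::{field,finite} fls ^ 'd ^ 'd"
  assumes "lattice h \<in> unimodular_lattices"
    and empty: "lattice h \<inter> vanishing_box (\<lambda>_. 0) \<subseteq> {0}"
    and W: "\<And>j. column j W \<in> lattice h"
    and int: "\<And>i j k. k < 0 \<Longrightarrow> W $ i $ j $$ k = 0"
    and off: "\<And>i j. i \<noteq> j \<Longrightarrow> W $ i $ j $$ 0 = 0"
    and diag: "\<And>i. W $ i $ i $$ 0 \<noteq> 0"
  shows "lattice h \<in> well_rounded_lattices"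
proof -
  have dW: "det W \<noteq> 0"
    using fls_subdegree_det_diagonal_residue int off diag by blast
  have norm_W: "vec_norm (column j W) = 1" for j
  proof -
    have "vec_norm (column j W) \<le> 1"
      unfolding vec_norm_le_1_iff using int by (simp add: vanishing_box_def column_def)
    moreover have "\<not> vec_norm (column j W) < 1"
      unfolding vec_norm_less_1_iff using diag[of j] by (auto simp: vanishing_box_def column_def)
    ultimately show ?thesis by simp
  qed
  have W_nz: "column j W \<noteq> 0" for j
    using diag[of j] by (metis column_def fls_zero_nth vec_lambda_beta zero_index)
  have "shortest_length (lattice h) = 1"
    unfolding shortest_length_def
  proof (rule Least_equality)
    show "1 \<in> vec_norm ` (lattice h - {0})"
      using norm_W W W_nz by (intro image_eqI[where x = "column undefined W"]) auto
    show "1 \<le> r" if "r \<in> vec_norm ` (lattice h - {0})" for r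
    proof -
      obtain v where v: "v \<in> lattice h" "v \<noteq> 0" "r = vec_norm v"
        using \<open>r \<in> _\<close> by auto
      then have "v \<notin> vanishing_box (\<lambda>_. 0)"
        using empty by blast
      then show ?thesis
        using v(3) vec_norm_less_1_iff[of v] by simp
    qed
  qed
  moreover have "inj (\<lambda>j. column j W)"
    using dW det_identical_columns by (metis injI)
  then have "card (columns W) = CARD('d)"
    by (simp add: columns_def full_SetCompr_eq card_image)
  moreover have "vec.independent (columns W)"
    using dW det_dependent_rows[of "transpose W"] by (auto simp: rows_transpose)
  moreover have "columns W \<subseteq> lattice h"
    using W by (auto simp: columns_def)
  moreover have "vec_norm v = 1" if "v \<in> columns W" for v
    using that norm_W by (auto simp: columns_def)
  ultimately show ?thesis
    using assms(1) by (auto simp: well_rounded_lattices_def)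
qed

theorem theorem1p35:
  fixes \<Lambda> :: "('a::{field,finite} fls ^ 'd) set"
  assumes "CARD('d) \<ge> 2"
    and "\<Lambda> \<in> unimodular_lattices"
  shows "diagonal_orbit \<Lambda> \<inter> well_rounded_lattices \<noteq> {}"
proof -
  obtain g :: "'a fls ^ 'd ^ 'd" where \<Lambda>: "\<Lambda> = lattice g"
    and g: "invertible g" "fls_abs (det g) = 1"
    using assms(2) by (auto simp: unimodular_lattices_def lattice_def)
  obtain m where empty: "lattice g \<inter> vanishing_box m \<subseteq> {0}"
    and full: "\<forall>i. \<not> lattice g \<inter> vanishing_box (m(i := m i - 1)) \<subseteq> {0}"
    by (rule maximal_empty_box[OF g(1)])
  have "\<exists>v. v \<in> lattice g \<and> v \<in> vanishing_box (m(i := m i - 1)) \<and> v \<notin> vanishing_box m" for i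
    using full empty by blast
  then obtain v where v: "\<And>i. v i \<in> lattice g" "\<And>i. v i \<in> vanishing_box (m(i := m i - 1))"
     "\<And>i. v i \<notin> vanishing_box m"
    by metis
  define a :: "'a fls ^ 'd ^ 'd" where "a = diag_scaling m"
  define h where "h = a ** g"
  define W where "W = (\<chi> i j. (a *v v j) $ i)"
  \<comment> \<open>The enlarged box differs from the empty one only in the position \<open>m i\<close> of entry \<open>i\<close>.\<close>
  have v_nz: "v i $ i $$ m i \<noteq> 0" for i
  proof
    assume "v i $ i $$ m i = 0"
    then have "v i $ j $$ k = 0" if "k \<le> m j" for j k
      using v(2)[of i] that by (cases "j = i"; cases "k = m i") (auto simp: vanishing_box_def)
    then show False
      using v(3)[of i] by (simp add: vanishing_box_def)
  qed
  have W: "column j W \<in> lattice h" for j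
  proof -
    have "column j W = a *v v j"
      by (simp add: W_def column_def vec_eq_iff)
    then show ?thesis
      by (simp add: h_def lattice_matrix_mult v(1))
  qed
  have int: "W $ i $ j $$ k = 0" if "k < 0" for i j k
    using that v(2)[of j] by (auto simp: W_def a_def diag_scaling_mult vanishing_box_def split: if_splits)
  have off: "W $ i $ j $$ 0 = 0" if "i \<noteq> j" for i j
    using that v(2)[of j] by (auto simp: W_def a_def diag_scaling_mult vanishing_box_def)
  have diag: "W $ i $ i $$ 0 \<noteq> 0" for i
    using v_nz by (simp add: W_def a_def diag_scaling_mult)
  have h_empty: "lattice h \<inter> vanishing_box (\<lambda>_. 0) \<subseteq> {0}"
    using empty by (auto simp: h_def a_def lattice_matrix_mult diag_scaling_in_vanishing_box_iff)
  have det_g: "det g \<noteq> 0" "fls_subdegree (det g) = 0"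
    using g(2) by (simp_all add: fls_abs_1_iffs)
  have det_h: "det h = fls_X_intpow (- (\<Sum>i\<in>UNIV. m i)) * det g"
    by (simp add: h_def a_def det_mul det_diag_scaling)
  then have "det h \<noteq> 0"
    using det_g(1) by (simp add: fls_shift_eq0_iff)
  then have "fls_subdegree (det h) = 0"
    using fls_subdegree_det_eq_0_if_residually_diagonal h_empty W int off diag by blast
  moreover have "fls_subdegree (det h) = - (\<Sum>i\<in>UNIV. m i)"
    using det_g unfolding det_h by (subst fls_subdegree_mult_fls_X_intpow) auto
  ultimately have det_a: "det a = 1"
    by (simp add: a_def det_diag_scaling)
  then have "a \<in> diagonal_group"
    by (simp add: diagonal_group_def a_def diag_scaling_def)
  then have "lattice h \<in> diagonal_orbit \<Lambda>"
    by (auto simp: diagonal_orbit_def h_def lattice_matrix_mult \<Lambda>)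
  moreover have "lattice h \<in> unimodular_lattices"
  proof -
    have "det h = det g"
      by (simp add: h_def det_mul det_a)
    then show ?thesis
      using g unfolding unimodular_lattices_def lattice_def
      by (auto simp: invertible_det_nz intro!: exI[of _ h])
  qed
  then have "lattice h \<in> well_rounded_lattices"
    using well_rounded_if_residually_diagonal h_empty W int off diag by blast
  ultimately show ?thesis by blast
qed

end
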